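(* The number of Motzkin trees (of size $n$) with unary height at most equal to $k$ is $$[z^n]B_{\le k}(z)\sim\tilde C\,\tilde\rho_k^{\,-n}\,n^{-\frac32},$$ as $n\to\infty$, where $\tilde\rho_k$ is the smallest real positive root of $\tilde R_k(z)=0$ and $\tilde C$ is a suitable constant.
   Context: A Motzkin tree is a finite plane rooted tree in which every node has 0, 1 or 2 children; nodes with exactly one child are called unary. The size is the total number of nodes. The unary height of a leaf is the number of unary nodes on the path from the root to it, and the unary height of the tree is the maximal unary height of a leaf. $B_{\le k}(z)$ is the generating function, by size, of Motzkin trees with unary height at most $k$. The functions $\tilde R_k$ are defined by $\tilde R_0(z)=1-4z^2$ and $\tilde R_k(z)=1-2z-4z^2+2z\sqrt{\tilde R_{k-1}(z)}$; one has $B_{\le k}(z)=\frac{1-\sqrt{\tilde R_k(z)}}{2z}$. The notation $a_n\sim b_n$ means $a_n/b_n\to1$.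
   Formalization: For k = 0 the claim fails for all n, since trees without unary nodes have odd size and the even coefficients vanish; there the asymptotics is stated for n tending to infinity through odd numbers only. For k ≥ 1 it is as stated. *)

theory Defs
  imports
    Complex_Main
    "HOL-Library.Landau_Symbols"
    "HOL-Computational_Algebra.Formal_Power_Series"
begin

datatype motzkin = Leaf | Unary motzkin | Binary motzkin motzkin

(* Total number of nodes, leaves included; the library's generic size function
   would give leaves the value 0. *)
primrec nodes :: "motzkin \<Rightarrow> nat" where
  "nodes Leaf = 1"
| "nodes (Unary t) = Suc (nodes t)"
| "nodes (Binary l r) = Suc (nodes l + nodes r)"

primrec leaf_unary_heights :: "motzkin \<Rightarrow> nat set" where
  "leaf_unary_heights Leaf = {0}"
| "leaf_unary_heights (Unary t) = Suc ` leaf_unary_heights t"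
| "leaf_unary_heights (Binary l r) = leaf_unary_heights l \<union> leaf_unary_heights r"

lemma finite_leaf_unary_heights: "finite (leaf_unary_heights t)"
  by (induction t) auto

lemma leaf_unary_heights_nonempty: "leaf_unary_heights t \<noteq> {}"
  by (induction t) auto

definition unary_height :: "motzkin \<Rightarrow> nat" where
  "unary_height t = Max (leaf_unary_heights t)"

definition motzkin_trees_le :: "nat \<Rightarrow> nat \<Rightarrow> motzkin set" where
  "motzkin_trees_le k n = {t. nodes t = n \<and> unary_height t \<le> k}"

lemma finite_nodes_le: "finite {t. nodes t \<le> n}"
proof (induction n)
  case 0
  have "nodes t \<noteq> 0" for t
    by (cases t) auto
  then have "{t. nodes t \<le> 0} = {}"
    by simp
  then show ?case
    by (simp only: finite.emptyI)
next
  case (Suc n)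
  let ?S = "{t. nodes t \<le> n}"
  have "{t. nodes t \<le> Suc n} \<subseteq> {Leaf} \<union> Unary ` ?S \<union> case_prod Binary ` (?S \<times> ?S)"
  proof
    fix t assume "t \<in> {t. nodes t \<le> Suc n}"
    then show "t \<in> {Leaf} \<union> Unary ` ?S \<union> case_prod Binary ` (?S \<times> ?S)"
      by (cases t) auto
  qed
  then show ?case
    by (rule finite_subset) (use Suc in auto)
qed

lemma finite_motzkin_trees_le: "finite (motzkin_trees_le k n)"
  by (rule finite_subset[OF _ finite_nodes_le[of n]]) (auto simp: motzkin_trees_le_def)

definition B_le :: "nat \<Rightarrow> real fps" where
  "B_le k = Abs_fps (\<lambda>n. real (card (motzkin_trees_le k n)))"

(* The square root is the principal branch, so that the square root of R_tilde k is 1 at z = 0. *)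
primrec R_tilde :: "nat \<Rightarrow> complex \<Rightarrow> complex" where
  "R_tilde 0 z = 1 - 4 * z ^ 2"
| "R_tilde (Suc k) z = 1 - 2 * z - 4 * z ^ 2 + 2 * z * csqrt (R_tilde k z)"

definition smallest_positive_root :: "(complex \<Rightarrow> complex) \<Rightarrow> real \<Rightarrow> bool" where
  "smallest_positive_root f x \<longleftrightarrow>
     0 < x \<and> f (of_real x) = 0 \<and> (\<forall>y>0. f (of_real y) = 0 \<longrightarrow> x \<le> y)"

(* Trees without unary nodes have odd size, so for k = 0 every even coefficient of B_le k
   vanishes and n has to tend to infinity through the odd numbers. For k > 0 there is no
   restriction on n. *)
definition sizes_at_top :: "nat \<Rightarrow> nat filter" where
  "sizes_at_top k = (if k = 0 then inf sequentially (principal {n. odd n}) else sequentially)"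

end

theory Submission
  imports Defs "HOL-Complex_Analysis.Complex_Analysis" "HOL-Real_Asymp.Real_Asymp"
begin

text \<open>Write \<open>S = 1 - 2 z B\<close> for the generating function \<open>B\<close> of height at most \<open>k\<close>. Then
  \<open>S\<^sup>2 = 1 - F\<close> where \<open>F = 4 z\<^sup>2 (1 + B')\<close> has nonnegative coefficients and \<open>B'\<close> belongs to
  height at most \<open>k - 1\<close> (\<open>B' = 0\<close> for \<open>k = 0\<close>). For \<open>k > 0\<close> the coefficients of \<open>z\<^sup>2\<close> and
  \<open>z\<^sup>3\<close> in \<open>F\<close> are positive, so on the closed disc of radius \<open>\<rho>\<close>, where \<open>F \<rho> = 1\<close>, the only
  zero of \<open>1 - F\<close> is the simple zero \<open>\<rho>\<close>. The singularity of \<open>B'\<close> lies further out, hence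
  \<open>S = sqrt (1 - z/\<rho>) \<cdot> G\<close> with \<open>G\<close> holomorphic on a larger disc. The coefficients of the
  first factor are explicit binomial coefficients, and dominated convergence in the Cauchy product
  shows that multiplying by \<open>G\<close> only contributes the factor \<open>G \<rho>\<close>. For \<open>k = 0\<close> the
  coefficients are explicit.\<close>

section \<open>The recursion for the generating functions\<close>

lemma unary_height_simps [simp]:
  "unary_height Leaf = 0"
  "unary_height (Unary t) = Suc (unary_height t)"
  "unary_height (Binary l r) = max (unary_height l) (unary_height r)"
proof -
  show "unary_height (Unary t) = Suc (unary_height t)"
    unfolding unary_height_def leaf_unary_heights.simps
    by (rule mono_Max_commute[symmetric])
       (auto simp: mono_def finite_leaf_unary_heights leaf_unary_heights_nonempty)
qed (auto simp: unary_height_def finite_leaf_unary_heights leaf_unary_heights_nonempty Max_Un)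

lemma nodes_pos: "nodes t > 0"
  by (cases t) auto

lemma motzkin_trees_le_0: "motzkin_trees_le k 0 = {}"
  using nodes_pos by (force simp: motzkin_trees_le_def)

text \<open>The index \<open>n\<close> counts the nodes below the root, so these trees have size
  \<open>n + 1\<close>; the same convention holds for \<open>binary_roots\<close>.\<close>

definition unary_roots :: "nat \<Rightarrow> nat \<Rightarrow> motzkin set" where
  "unary_roots k n = (case k of 0 \<Rightarrow> {} | Suc j \<Rightarrow> Unary ` motzkin_trees_le j n)"

definition binary_roots :: "nat \<Rightarrow> nat \<Rightarrow> motzkin set" where
  "binary_roots k n =
     case_prod Binary ` (\<Union>i\<le>n. motzkin_trees_le k i \<times> motzkin_trees_le k (n - i))"

lemma motzkin_trees_le_Suc:
  "motzkin_trees_le k (Suc n) = (if n = 0 then {Leaf} else {}) \<union> unary_roots k n \<union> binary_roots k n"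
proof (rule set_eqI)
  fix t
  show "t \<in> motzkin_trees_le k (Suc n) \<longleftrightarrow>
    t \<in> (if n = 0 then {Leaf} else {}) \<union> unary_roots k n \<union> binary_roots k n"
  proof (cases t)
    case Leaf
    then show ?thesis
      by (auto simp: motzkin_trees_le_def unary_roots_def binary_roots_def split: nat.splits)
  next
    case (Unary s)
    then show ?thesis
      by (auto simp: motzkin_trees_le_def unary_roots_def binary_roots_def split: nat.splits)
  next
    case (Binary l r)
    then show ?thesis
      by (auto simp: motzkin_trees_le_def unary_roots_def binary_roots_def image_iff split: nat.splits)
  qed
qed

lemma card_binary_roots:
  "card (binary_roots k n) =
     (\<Sum>i\<le>n. card (motzkin_trees_le k i) * card (motzkin_trees_le k (n - i)))"
proof -
  have "inj_on (case_prod Binary) A" for A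
    by (auto simp: inj_on_def)
  then have "card (binary_roots k n) =
      card (\<Union>i\<le>n. motzkin_trees_le k i \<times> motzkin_trees_le k (n - i))"
    unfolding binary_roots_def by (rule card_image)
  also have "\<dots> = (\<Sum>i\<le>n. card (motzkin_trees_le k i \<times> motzkin_trees_le k (n - i)))"
    \<comment> \<open>The products are disjoint because the size of the left subtree determines
      \<open>i\<close>.\<close>
    by (rule card_UN_disjoint) (auto simp: finite_motzkin_trees_le, auto simp: motzkin_trees_le_def)
  finally show ?thesis
    by (simp add: card_cartesian_product)
qed

lemma card_motzkin_trees_le_Suc:
  "card (motzkin_trees_le k (Suc n)) =
     (if n = 0 then 1 else 0) + (case k of 0 \<Rightarrow> 0 | Suc j \<Rightarrow> card (motzkin_trees_le j n)) +
     (\<Sum>i\<le>n. card (motzkin_trees_le k i) * card (motzkin_trees_le k (n - i)))"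
proof -
  have fin: "finite (unary_roots k n)" "finite (binary_roots k n)"
    by (auto simp: unary_roots_def binary_roots_def finite_motzkin_trees_le split: nat.splits)
  have card_unary: "card (unary_roots k n) = (case k of 0 \<Rightarrow> 0 | Suc j \<Rightarrow> card (motzkin_trees_le j n))"
    by (auto simp: unary_roots_def card_image inj_on_def split: nat.splits)
  have disj: "({Leaf} \<union> unary_roots k n) \<inter> binary_roots k n = {}" "Leaf \<notin> unary_roots k n"
    by (auto simp: unary_roots_def binary_roots_def split: nat.splits)
  show ?thesis
    unfolding motzkin_trees_le_Suc
    by (subst card_Un_disjoint; (subst card_Un_disjoint)?)
       (use fin disj in \<open>auto simp: card_unary card_binary_roots\<close>)
qed

text \<open>This is the series \<open>B'\<close> of the overview: what may hang below a unary
  root.\<close>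

definition unary_subtree_fps :: "nat \<Rightarrow> real fps" where
  "unary_subtree_fps k = (case k of 0 \<Rightarrow> 0 | Suc j \<Rightarrow> B_le j)"

lemma B_le_nth_nonneg: "fps_nth (B_le k) n \<ge> 0"
  by (simp add: B_le_def)

lemma B_le_nth_0 [simp]: "fps_nth (B_le k) 0 = 0"
  by (simp add: B_le_def motzkin_trees_le_0)

lemma B_le_nth_1: "fps_nth (B_le k) (Suc 0) = 1"
  by (cases k) (simp_all add: B_le_def card_motzkin_trees_le_Suc motzkin_trees_le_0)

text \<open>The three summands correspond to a root that is a leaf, unary or binary.\<close>

lemma B_le_fps_eq: "B_le k = fps_X * (1 + unary_subtree_fps k + B_le k * B_le k)"
proof (rule fps_ext)
  fix n
  have "fps_nth (B_le k * B_le k) m =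
      real (\<Sum>i\<le>m. card (motzkin_trees_le k i) * card (motzkin_trees_le k (m - i)))" for m
    by (simp add: B_le_def fps_mult_nth atLeast0AtMost)
  moreover have "fps_nth (unary_subtree_fps k) m =
      real (case k of 0 \<Rightarrow> 0 | Suc j \<Rightarrow> card (motzkin_trees_le j m))" for m
    by (simp add: unary_subtree_fps_def B_le_def split: nat.splits)
  moreover have "fps_nth (B_le k) m = real (card (motzkin_trees_le k m))" for m
    by (simp add: B_le_def)
  ultimately show "fps_nth (B_le k) n = fps_nth (fps_X * (1 + unary_subtree_fps k + B_le k * B_le k)) n"
    by (cases n) (simp_all add: motzkin_trees_le_0 card_motzkin_trees_le_Suc)
qed

definition F_fps :: "nat \<Rightarrow> real fps" where
  "F_fps k = 4 * fps_X ^ 2 * (1 + unary_subtree_fps k)"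

definition S_fps :: "nat \<Rightarrow> real fps" where
  "S_fps k = 1 - 2 * fps_X * B_le k"

text \<open>Completing the square in the quadratic equation for \<open>B_le k\<close>;
  \<open>1 - F_fps k\<close> is its discriminant and the formal counterpart of
  \<open>R_tilde k\<close>.\<close>

lemma S_fps_squared: "S_fps k ^ 2 = 1 - F_fps k"
proof -
  have "fps_X * B_le k = fps_X * (fps_X * (1 + unary_subtree_fps k + B_le k * B_le k))"
    using B_le_fps_eq by metis
  then show ?thesis
    unfolding S_fps_def F_fps_def by algebra
qed

lemma S_fps_nth_Suc: "fps_nth (S_fps k) (Suc n) = - 2 * fps_nth (B_le k) n"
  unfolding S_fps_def by (simp add: mult.assoc numeral_fps_const)

lemma F_fps_nonneg: "fps_nth (F_fps k) n \<ge> 0"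
  by (auto simp: F_fps_def mult.assoc fps_X_power_mult_nth unary_subtree_fps_def
      numeral_fps_const B_le_nth_nonneg split: nat.splits)

text \<open>The cubic term comes from the single leaf below a unary node. It is absent at level 0,
  where \<open>F = 4 z^2\<close> takes the value 1 at both 1/2 and -1/2.\<close>

lemma F_fps_coeffs_pos:
  "fps_nth (F_fps (Suc k)) 2 > 0" "fps_nth (F_fps (Suc k)) 3 > 0"
  by (simp_all add: F_fps_def mult.assoc fps_X_power_mult_nth unary_subtree_fps_def
      numeral_fps_const B_le_nth_1)

section \<open>Asymptotics of convolutions\<close>

lemma gchoose_half_asymptotic:
  "(\<lambda>n. (-1) ^ n * ((1/2 :: real) gchoose n) * real n powr (3/2)) \<longlonglongrightarrow> inverse (Gamma (- 1/2))"
proof -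
  have "(\<lambda>n. ((1/2 :: real) gchoose n) / ((-1)^n / exp ((1/2+1) * of_real (ln (real n)))))
      \<longlonglongrightarrow> inverse (Gamma (- (1/2)))"
    by (rule gbinomial_asymptotic)
  moreover have "\<forall>\<^sub>F n in sequentially. ((1/2 :: real) gchoose n) / ((-1)^n / exp ((1/2+1) * of_real (ln (real n))))
      = (-1) ^ n * ((1/2 :: real) gchoose n) * real n powr (3/2)"
    using eventually_gt_at_top[of 0]
    by eventually_elim (simp add: powr_def field_simps)
  ultimately show ?thesis
    by (simp add: tendsto_cong)
qed

lemma Gamma_minus_half_nonzero: "Gamma (- 1/2 :: real) \<noteq> 0"
proof -
  have "(- 1/2 :: real) \<notin> \<int>\<^sub>\<le>\<^sub>0"
  proof
    assume "(- 1/2 :: real) \<in> \<int>\<^sub>\<le>\<^sub>0"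
    then obtain m where "(- 1/2 :: real) = - real m"
      by (auto elim: nonpos_Ints_cases')
    then have "real (2 * m) = real 1"
      by simp
    then have "2 * m = 1"
      by (simp only: of_nat_eq_iff)
    then show False by presburger
  qed
  then show ?thesis
    by (simp add: Gamma_eq_zero_iff)
qed

text \<open>For fixed \<open>j\<close> the weighted summand tends to \<open>c * g j\<close>; the
  weight on \<open>g\<close> provides a summable majorant, so Tannery's theorem exchanges limit and
  sum.\<close>

lemma convolution_powr_limit:
  fixes q g :: "nat \<Rightarrow> complex"
  assumes q: "(\<lambda>n. q n * of_real (real n powr (3/2))) \<longlonglongrightarrow> c"
    and g: "summable (\<lambda>j. norm (g j) * (real j + 1) ^ 2)"
  shows "(\<lambda>n. (\<Sum>j\<le>n. q (n - j) * g j) * of_real (real n powr (3/2))) \<longlonglongrightarrow> c * suminf g"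
proof -
  define a where "a j n = (if j \<le> n then q (n - j) * g j * of_real (real n powr (3/2)) else 0)" for j n
  have shifted: "(\<lambda>n. q n * of_real ((real n + real j) powr (3/2))) \<longlonglongrightarrow> c" for j
  proof -
    have "(\<lambda>n. (real n + real j) powr (3/2) / real n powr (3/2)) \<longlonglongrightarrow> 1"
      by real_asymp
    then have "(\<lambda>n. (q n * of_real (real n powr (3/2))) *
        of_real ((real n + real j) powr (3/2) / real n powr (3/2))) \<longlonglongrightarrow> c * of_real 1"
      by (intro tendsto_mult q tendsto_of_real)
    moreover have "\<forall>\<^sub>F n in sequentially. (q n * of_real (real n powr (3/2))) *
        of_real ((real n + real j) powr (3/2) / real n powr (3/2))
        = q n * of_real ((real n + real j) powr (3/2))"
      using eventually_gt_at_top[of 0] by eventually_elim simp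
    ultimately show ?thesis
      by (simp add: tendsto_cong)
  qed
  have lim: "(\<lambda>n. a j n) \<longlonglongrightarrow> c * g j" for j
  proof (rule LIMSEQ_offset[of _ j])
    have "(\<lambda>n. q n * of_real ((real n + real j) powr (3/2)) * g j) \<longlonglongrightarrow> c * g j"
      by (intro tendsto_mult shifted tendsto_const)
    then show "(\<lambda>n. a j (n + j)) \<longlonglongrightarrow> c * g j"
      by (simp add: a_def mult_ac)
  qed
  \<comment> \<open>The shift by 1 keeps the weight positive at \<open>n = 0\<close>, so that
    \<open>q 0\<close> is controlled too.\<close>
  have "Bseq (\<lambda>n. q n * of_real ((real n + real 1) powr (3/2)))"
    using shifted[of 1] by (intro convergent_imp_Bseq convergentI)
  then obtain M where M: "M > 0" "\<And>n. norm (q n * of_real ((real n + real 1) powr (3/2))) \<le> M"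
    by (auto simp: Bseq_def)
  have bound: "norm (a j n) \<le> M * (norm (g j) * (real j + 1) ^ 2)" for j n
  proof (cases "j \<le> n")
    case True
    define m where "m = n - j"
    have n: "n = m + j" using True by (simp add: m_def)
    \<comment> \<open>From \<open>m + j \<le> (m + 1) * (j + 1)\<close> the weight splits into a
      part absorbed by \<open>q\<close> and a part absorbed by \<open>g\<close>.\<close>
    have "real n powr (3/2) \<le> ((real m + 1) * (real j + 1)) powr (3/2)"
      by (intro powr_mono2) (auto simp: n algebra_simps)
    also have "\<dots> = (real m + 1) powr (3/2) * (real j + 1) powr (3/2)"
      by (simp add: powr_mult)
    also have "(real j + 1) powr (3/2) \<le> (real j + 1) powr 2"
      by (intro powr_mono) auto
    also have "(real j + 1) powr 2 = (real j + 1) ^ 2"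
      by simp
    finally have *: "real n powr (3/2) \<le> (real m + 1) powr (3/2) * (real j + 1) ^ 2"
      by (simp add: mult_left_mono)
    have "norm (a j n) = norm (q m) * norm (g j) * real n powr (3/2)"
      using True by (simp add: a_def norm_mult m_def)
    also have "\<dots> \<le> norm (q m) * norm (g j) * ((real m + 1) powr (3/2) * (real j + 1) ^ 2)"
      by (intro mult_left_mono *) auto
    also have "\<dots> = norm (q m * of_real ((real m + real 1) powr (3/2))) * (norm (g j) * (real j + 1) ^ 2)"
      by (simp add: norm_mult)
    also have "\<dots> \<le> M * (norm (g j) * (real j + 1) ^ 2)"
      by (intro mult_right_mono M) auto
    finally show ?thesis .
  next
    case False
    then show ?thesis using M by (simp add: a_def)
  qed
  have "(\<lambda>n. \<Sum>j. a j n) \<longlonglongrightarrow> (\<Sum>j. c * g j)"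
    using tannerys_theorem[of a "\<lambda>j. c * g j" sequentially "\<lambda>j. M * (norm (g j) * (real j + 1) ^ 2)"]
      lim bound g by (auto intro: summable_mult always_eventually)
  moreover have "(\<Sum>j. a j n) = (\<Sum>j\<le>n. q (n - j) * g j) * of_real (real n powr (3/2))" for n
  proof -
    have "(\<Sum>j. a j n) = (\<Sum>j\<le>n. a j n)"
      by (rule suminf_finite) (auto simp: a_def)
    then show ?thesis by (simp add: a_def sum_distrib_right)
  qed
  moreover have "summable g"
  proof (rule summable_norm_cancel, rule summable_comparison_test'[OF g])
    show "norm (norm (g j)) \<le> norm (g j) * (real j + 1) ^ 2" if "j \<ge> 0" for j
      using mult_left_mono[of 1 "(real j + 1) ^ 2" "norm (g j)"] by (simp add: one_le_power)
  qed
  ultimately show ?thesis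
    by (simp add: suminf_mult)
qed

text \<open>A radius \<open>r\<close> strictly between \<open>\<rho>\<close> and the radius of
  convergence leaves a geometric factor \<open>(\<rho> / r) ^ j\<close>, which beats the polynomial
  weight.\<close>

lemma summable_polynomial_weight:
  fixes G :: "complex fps"
  assumes "0 < \<rho>" "ereal \<rho> < fps_conv_radius G"
  shows "summable (\<lambda>j. norm (fps_nth G j * of_real \<rho> ^ j) * (real j + 1) ^ 2)"
proof -
  obtain r where r: "ereal \<rho> < ereal r" "ereal r < fps_conv_radius G"
    using ereal_dense2[OF assms(2)] by auto
  define x where "x = \<rho> / r"
  have x: "0 < x" "x < 1"
    using r assms by (auto simp: x_def)
  have "(\<lambda>j. (real j + 1) ^ 2 * x ^ j) \<longlonglongrightarrow> 0"
    using x by real_asymp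
  then have "Bseq (\<lambda>j. (real j + 1) ^ 2 * x ^ j)"
    by (intro convergent_imp_Bseq convergentI)
  then obtain M where M: "\<And>j. norm ((real j + 1) ^ 2 * x ^ j) \<le> M"
    by (auto simp: Bseq_def)
  have "summable (\<lambda>j. norm (fps_nth G j * of_real r ^ j))"
    using r assms by (intro abs_summable_in_conv_radius) (auto simp: fps_conv_radius_def)
  then have "summable (\<lambda>j. M * norm (fps_nth G j * of_real r ^ j))"
    by (rule summable_mult)
  then show ?thesis
  proof (rule summable_comparison_test')
    fix j :: nat
    assume "j \<ge> 0"
    have "norm (fps_nth G j * of_real \<rho> ^ j) * (real j + 1) ^ 2
      = norm (fps_nth G j * of_real r ^ j) * ((real j + 1) ^ 2 * x ^ j)"
      using r assms by (simp add: x_def norm_mult norm_power power_divide)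
    also have "\<dots> \<le> norm (fps_nth G j * of_real r ^ j) * M"
      using M[of j] x by (intro mult_left_mono) auto
    finally show "norm (norm (fps_nth G j * of_real \<rho> ^ j) * (real j + 1) ^ 2) \<le> M * norm (fps_nth G j * of_real r ^ j)"
      by (simp add: mult_ac)
  qed
qed

section \<open>Square-root singularities\<close>

text \<open>The binomial series of \<open>sqrt (1 + c z)\<close>, obtained by substitution so that
  its square can be computed formally.\<close>

definition sqrt_linear :: "'a::field_char_0 \<Rightarrow> 'a fps" where
  "sqrt_linear c = fps_binomial (1/2) oo (fps_const c * fps_X)"

lemma sqrt_linear_nth: "fps_nth (sqrt_linear c) n = c ^ n * ((1/2) gchoose n)"
  by (simp add: sqrt_linear_def fps_compose_linear)

lemma fps_binomial_half_squared: "fps_binomial (1/2) ^ 2 = (1 + fps_X :: 'a::field_char_0 fps)"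
  by (simp add: fps_binomial_power fps_binomial_1)

lemma sqrt_linear_squared: "sqrt_linear c ^ 2 = 1 + fps_const c * fps_X"
  by (simp add: sqrt_linear_def fps_compose_power fps_binomial_half_squared fps_compose_add_distrib)

lemma sqrt_linear_conv_radius:
  fixes c :: "'a::{banach, real_normed_field}"
  assumes "c \<noteq> 0"
  shows "fps_conv_radius (sqrt_linear c) \<ge> ereal (1 / norm c)"
proof -
  have "fps_conv_radius (sqrt_linear c) = conv_radius (\<lambda>n. (1/2 :: 'a) gchoose n) / ereal (norm c)"
    using assms by (simp add: fps_conv_radius_def sqrt_linear_nth conv_radius_mult_power)
  also have "\<dots> \<ge> ereal (1 / norm c)"
    using assms by (auto simp: conv_radius_gchoose one_ereal_def)
  finally show ?thesis .
qed

section \<open>Real power series viewed over the complex numbers\<close>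

definition complex_fps :: "real fps \<Rightarrow> complex fps" where
  "complex_fps F = Abs_fps (\<lambda>n. of_real (fps_nth F n))"

lemma complex_fps_nth [simp]: "fps_nth (complex_fps F) n = of_real (fps_nth F n)"
  by (simp add: complex_fps_def)

lemma complex_fps_mult: "complex_fps (F * G) = complex_fps F * complex_fps G"
  by (simp add: fps_eq_iff fps_mult_nth)

lemma complex_fps_one_minus: "complex_fps (1 - F) = 1 - complex_fps F"
  by (simp add: fps_eq_iff)

lemma complex_fps_conv_radius [simp]: "fps_conv_radius (complex_fps F) = fps_conv_radius F"
  unfolding fps_conv_radius_def
  by (subst (1 2) conv_radius_norm[symmetric]) simp

lemma eval_complex_fps:
  assumes "norm x < fps_conv_radius F"
  shows "eval_fps (complex_fps F) (of_real x) = of_real (eval_fps F x)"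
proof -
  have "summable (\<lambda>n. fps_nth F n * x ^ n)"
    using assms by (rule summable_fps)
  then show ?thesis
    by (simp add: eval_fps_def suminf_of_real)
qed

section \<open>Location and simplicity of the zero of \<open>1 - F\<close>\<close>

lemma complex_eq_of_real_if_Re_eq:
  assumes "norm z \<le> x" "Re z = x"
  shows "z = of_real x"
proof -
  have "\<bar>Re z\<bar> \<le> norm z" "norm z ^ 2 = Re z ^ 2 + Im z ^ 2"
    by (simp_all add: abs_Re_le_cmod cmod_power2)
  moreover have "norm z = x"
    using assms abs_Re_le_cmod[of z] by linarith
  ultimately show ?thesis
    using assms by (simp add: complex_eq_iff)
qed

text \<open>Equality case of the triangle inequality: comparing real parts termwise forces
  \<open>z ^ n = \<rho> ^ n\<close> wherever the coefficient is positive. The exponents 2 and 3 then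
  give \<open>z = \<rho>\<close> by division.\<close>

lemma eval_fps_eq_one_imp_real:
  fixes F :: "real fps"
  assumes nonneg: "\<And>n. fps_nth F n \<ge> 0" and pos: "fps_nth F 2 > 0" "fps_nth F 3 > 0"
    and \<rho>: "0 < \<rho>" "ereal \<rho> < fps_conv_radius F" "eval_fps F \<rho> = 1"
    and z: "norm z \<le> \<rho>" "eval_fps (complex_fps F) z = 1"
  shows "z = of_real \<rho>"
proof -
  have "ereal (norm z) < fps_conv_radius (complex_fps F)"
    using z \<rho> by (auto intro: le_less_trans[of _ "ereal \<rho>"])
  then have "(\<lambda>n. fps_nth (complex_fps F) n * z ^ n) sums 1"
    using z summable_sums[OF summable_fps, of z "complex_fps F"] by (simp add: eval_fps_def)
  then have "(\<lambda>n. fps_nth F n * Re (z ^ n)) sums 1"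
    using sums_Re by fastforce
  moreover have "(\<lambda>n. fps_nth F n * \<rho> ^ n) sums 1"
    using \<rho> summable_sums[OF summable_fps, of \<rho> F] by (simp add: eval_fps_def)
  ultimately have sums: "(\<lambda>n. fps_nth F n * (\<rho> ^ n - Re (z ^ n))) sums 0"
    using sums_diff by (fastforce simp: algebra_simps)
  have norm_le: "norm (z ^ n) \<le> \<rho> ^ n" for n
    unfolding norm_power using z by (intro power_mono) auto
  have nn: "fps_nth F n * (\<rho> ^ n - Re (z ^ n)) \<ge> 0" for n
    using nonneg[of n] norm_le[of n] complex_Re_le_cmod[of "z ^ n"] by (intro mult_nonneg_nonneg) auto
  have "fps_nth F n * (\<rho> ^ n - Re (z ^ n)) = 0" for n
    using sums nn suminf_eq_zero_iff[of "\<lambda>n. fps_nth F n * (\<rho> ^ n - Re (z ^ n))"]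
    by (auto simp: sums_iff)
  then have "Re (z ^ 2) = \<rho> ^ 2" "Re (z ^ 3) = \<rho> ^ 3"
    using pos by (metis eq_iff_diff_eq_0 less_irrefl mult_eq_0_iff)+
  then have "z ^ 2 = of_real (\<rho> ^ 2)" "z ^ 3 = of_real (\<rho> ^ 3)"
    using norm_le complex_eq_of_real_if_Re_eq by blast+
  moreover have "z ^ 3 = z * z ^ 2"
    by (simp add: power3_eq_cube power2_eq_square)
  ultimately have "z * of_real (\<rho> ^ 2) = of_real \<rho> * of_real (\<rho> ^ 2)"
    by (simp add: power3_eq_cube power2_eq_square mult.assoc)
  then show ?thesis
    using \<rho> by (metis mult_right_cancel of_real_eq_0_iff less_irrefl power_not_zero)
qed

text \<open>This makes \<open>\<rho>\<close> a simple zero of \<open>1 - F\<close>. The positive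
  term has index 1 in the derivative and stems from the quadratic coefficient.\<close>

lemma eval_fps_deriv_pos:
  fixes F :: "real fps"
  assumes nonneg: "\<And>n. fps_nth F n \<ge> 0" and pos: "fps_nth F 2 > 0"
    and \<rho>: "0 < \<rho>" "ereal \<rho> < fps_conv_radius F"
  shows "eval_fps (fps_deriv F) \<rho> > 0"
proof -
  have "ereal (norm \<rho>) < fps_conv_radius (fps_deriv F)"
    using \<rho> fps_conv_radius_deriv[of F] by (auto intro: less_le_trans)
  then have "summable (\<lambda>n. fps_nth (fps_deriv F) n * \<rho> ^ n)"
    by (rule summable_fps)
  then show ?thesis
    unfolding eval_fps_def using nonneg pos \<rho>
    by (rule_tac suminf_pos2[where i = 1]) (auto simp: numeral_2_eq_2)
qed

text \<open>By compactness, the zeros in a slightly larger closed disc, if there are any, include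
  one of least modulus, and this modulus serves as \<open>r'\<close>.\<close>

lemma nonvanishing_ball_extends:
  fixes h :: "complex \<Rightarrow> complex"
  assumes h: "continuous_on (ball 0 r) h" and "0 < \<rho>" "\<rho> < r"
    and nz: "\<And>z. norm z \<le> \<rho> \<Longrightarrow> h z \<noteq> 0"
  obtains r' where "\<rho> < r'" "r' < r" "\<And>z. norm z < r' \<Longrightarrow> h z \<noteq> 0"
proof -
  define s where "s = (\<rho> + r) / 2"
  have s: "\<rho> < s" "s < r" using assms by (auto simp: s_def)
  define Z where "Z = {z \<in> cball 0 s. h z = 0}"
  show ?thesis
  proof (cases "Z = {}")
    case True
    show ?thesis
      by (rule that[of s]) (use True s in \<open>auto simp: Z_def\<close>)
  next
    case False
    have "continuous_on (cball 0 s) h"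
      by (rule continuous_on_subset[OF h]) (use s in auto)
    then have "closed Z"
      unfolding Z_def by (intro continuous_closed_preimage_constant) auto
    moreover have "bounded Z"
      by (rule bounded_subset[OF bounded_cball[of 0 s]]) (auto simp: Z_def)
    ultimately have "compact Z"
      by (simp add: compact_eq_bounded_closed)
    then obtain w where w: "w \<in> Z" "\<And>z. z \<in> Z \<Longrightarrow> norm w \<le> norm z"
      using continuous_attains_inf[of Z norm] False by (auto intro: continuous_intros)
    show ?thesis
    proof (rule that[of "norm w"])
      show "\<rho> < norm w" "norm w < r"
        using w(1) nz[of w] s by (auto simp: Z_def not_le[symmetric])
      show "h z \<noteq> 0" if "norm z < norm w" for z
      proof
        assume "h z = 0"
        moreover have "norm z \<le> s"
          using w(1) that by (simp add: Z_def)
        ultimately show False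
          using w(2)[of z] that by (simp add: Z_def)
      qed
    qed
  qed
qed

text \<open>Dividing \<open>1 - F\<close> by its only zero leaves a function without zeros on a disc
  of radius larger than \<open>\<rho>\<close>. Discs are simply connected, so it has a holomorphic
  square root there; \<open>G\<close> is the Taylor series of that root.\<close>

lemma sqrt_factorization:
  fixes F :: "real fps"
  assumes nonneg: "\<And>n. fps_nth F n \<ge> 0" and pos: "fps_nth F 2 > 0" "fps_nth F 3 > 0"
    and \<rho>: "0 < \<rho>" "ereal \<rho> < fps_conv_radius F" "eval_fps F \<rho> = 1"
  obtains G :: "complex fps" where "ereal \<rho> < fps_conv_radius G" "eval_fps G (of_real \<rho>) \<noteq> 0"
    "(sqrt_linear (- 1 / of_real \<rho>) * G) ^ 2 = 1 - complex_fps F"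
proof -
  obtain r where r: "\<rho> < r" "ereal r < fps_conv_radius F"
    using ereal_dense2[OF \<rho>(2)] by auto
  have conv: "ereal (norm z) < fps_conv_radius F" if "z \<in> ball 0 r" for z :: complex
    using that r by (auto intro: less_trans[of _ "ereal r"])
  define f where "f = eval_fps (1 - complex_fps F)"
  have f: "f z = 1 - eval_fps (complex_fps F) z" if "z \<in> ball 0 r" for z
    unfolding f_def using conv[OF that] by (subst eval_fps_diff) auto
  have conv1: "fps_conv_radius (1 - complex_fps F) \<ge> fps_conv_radius F"
    using fps_conv_radius_diff[of 1 "complex_fps F"] by simp
  have f_hol: "f holomorphic_on ball 0 r"
    unfolding f_def using less_le_trans[OF conv conv1]
    by (intro holomorphic_on_eval_fps) (auto simp: in_eball_iff)
  have f_rho: "f (of_real \<rho>) = 0"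
    using \<rho> r by (subst f) (auto simp: eval_complex_fps)
  \<comment> \<open>The difference quotient of \<open>f\<close>, with its removable singularity at
    \<open>\<rho>\<close> filled in by the derivative.\<close>
  define h where "h z = (if z = of_real \<rho> then deriv f (of_real \<rho>)
      else (f z - f (of_real \<rho>)) / (z - of_real \<rho>))" for z
  have h_hol: "h holomorphic_on ball 0 r"
    unfolding h_def by (rule pole_lemma_open[OF f_hol]) auto
  have fh: "f z = (z - of_real \<rho>) * h z" for z
    by (auto simp: h_def f_rho)
  have "deriv f (of_real \<rho>) = eval_fps (fps_deriv (1 - complex_fps F)) (of_real \<rho>)"
    unfolding f_def using \<rho> conv1 by (intro eval_fps_deriv[symmetric]) (auto intro: less_le_trans)
  also have "fps_deriv (1 - complex_fps F) = - complex_fps (fps_deriv F)"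
    by (simp add: fps_eq_iff)
  also have "eval_fps (- complex_fps (fps_deriv F)) (of_real \<rho>) = - of_real (eval_fps (fps_deriv F) \<rho>)"
    using \<rho> fps_conv_radius_deriv[of F]
    by (subst eval_fps_minus) (auto simp: eval_complex_fps intro: less_le_trans)
  finally have "h (of_real \<rho>) \<noteq> 0"
    using eval_fps_deriv_pos[OF nonneg pos(1) \<rho>(1,2)] by (simp add: h_def)
  then have h_nz: "h z \<noteq> 0" if "norm z \<le> \<rho>" for z
    using eval_fps_eq_one_imp_real[OF nonneg pos \<rho> that] fh[of z] f[of z] that r
    by (cases "z = of_real \<rho>") auto
  obtain r' where r': "\<rho> < r'" "r' < r" "\<And>z. norm z < r' \<Longrightarrow> h z \<noteq> 0"
    using nonvanishing_ball_extends[OF holomorphic_on_imp_continuous_on[OF h_hol] \<rho>(1) r(1) h_nz] by blast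
  \<comment> \<open>The factor \<open>- \<rho>\<close> turns \<open>z - \<rho>\<close> into the
    normalized \<open>1 - z / \<rho>\<close>, whose square root is
    \<open>sqrt_linear (- 1 / \<rho>)\<close>.\<close>
  have "(\<lambda>z. - of_real \<rho> * h z) holomorphic_on ball 0 r'"
    using r' by (intro holomorphic_intros holomorphic_on_subset[OF h_hol]) auto
  moreover have "simply_connected (ball (0::complex) r')"
    by (intro convex_imp_simply_connected) auto
  ultimately obtain g where g: "g holomorphic_on ball 0 r'"
      "\<And>z. z \<in> ball 0 r' \<Longrightarrow> - of_real \<rho> * h z = g z ^ 2"
    using r' \<rho> simply_connected_eq_holomorphic_sqrt[of "ball (0::complex) r'"] by fastforce
  define G where "G = fps_expansion g 0"
  have g_hol: "g holomorphic_on eball 0 (ereal r')"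
    using g(1) by simp
  have G_conv: "fps_conv_radius G \<ge> ereal r'"
    unfolding G_def by (rule conv_radius_fps_expansion[OF g_hol])
  have G_eval: "eval_fps G z = g z" if "norm z < r'" for z
    using eval_fps_expansion'[OF g_hol, of z] that by (simp add: G_def)
  define L where "L = 1 + fps_const (- 1 / of_real \<rho> :: complex) * fps_X"
  have L_conv: "fps_conv_radius L = \<infinity>"
  proof -
    have "fps_conv_radius (fps_const (- 1 / of_real \<rho> :: complex) * fps_X) = \<infinity>"
      using \<rho> by (subst fps_conv_radius_cmult_left) auto
    then show ?thesis
      using fps_conv_radius_add[of 1 "fps_const (- 1 / of_real \<rho> :: complex) * fps_X"]
      by (simp add: L_def)
  qed
  have L_eval: "eval_fps L z = 1 - z / of_real \<rho>" for z
    using \<rho> unfolding L_def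
    by (simp add: eval_fps_add eval_fps_mult fps_conv_radius_cmult_left)
  have G2_conv: "fps_conv_radius (G ^ 2) \<ge> ereal r'"
    using fps_conv_radius_power[of G 2] G_conv by (rule order_trans[rotated])
  have LG_conv: "fps_conv_radius (L * G ^ 2) \<ge> ereal r'"
    using fps_conv_radius_mult[of L "G ^ 2"] G2_conv L_conv by (auto simp: min_def split: if_splits)
  \<comment> \<open>Agreement of the sums near 0 is lifted to an identity of formal series.\<close>
  have "L * G ^ 2 = 1 - complex_fps F"
  proof (rule eval_fps_eqD)
    show "fps_conv_radius (L * G ^ 2) > 0"
      using LG_conv r' \<rho> by (auto intro: less_le_trans[of _ "ereal r'"])
    show "fps_conv_radius (1 - complex_fps F) > 0"
      using conv1 \<rho> by (auto intro: less_le_trans[of _ "fps_conv_radius F"] less_trans[of _ "ereal \<rho>"])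
    have "\<forall>\<^sub>F z in nhds 0. z \<in> ball (0::complex) r'"
      using r' \<rho> by (intro eventually_nhds_in_open) auto
    then show "\<forall>\<^sub>F z in nhds 0. eval_fps (L * G ^ 2) z = eval_fps (1 - complex_fps F) z"
    proof eventually_elim
      case (elim z)
      then have z: "ereal (norm z) < ereal r'" by simp
      have "eval_fps (L * G ^ 2) z = eval_fps L z * eval_fps G z ^ 2"
        using less_le_trans[OF z G2_conv] less_le_trans[OF z G_conv]
        by (simp add: eval_fps_mult eval_fps_power L_conv)
      also have "\<dots> = (1 - z / of_real \<rho>) * (- of_real \<rho> * h z)"
        using elim g(2)[of z] by (simp add: L_eval G_eval)
      also have "\<dots> = f z"
        using \<rho> by (simp add: fh field_simps)
      finally show ?case by (simp add: f_def)
    qed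
  qed
  show ?thesis
  proof (rule that[of G])
    show "ereal \<rho> < fps_conv_radius G"
      using r' G_conv by (auto intro: less_le_trans[of _ "ereal r'"])
    have "g (of_real \<rho>) ^ 2 \<noteq> 0"
      using r' \<rho> g(2)[of "of_real \<rho>"] by auto
    then show "eval_fps G (of_real \<rho>) \<noteq> 0"
      using r' \<rho> by (simp add: G_eval)
    show "(sqrt_linear (- 1 / of_real \<rho>) * G) ^ 2 = 1 - complex_fps F"
      using \<open>L * G ^ 2 = 1 - complex_fps F\<close>
      by (simp add: power_mult_distrib sqrt_linear_squared L_def)
  qed
qed

text \<open>The first conclusion feeds the induction on \<open>k\<close>, since \<open>S\<close>
  enters the next \<open>F\<close>; the second gives the coefficient asymptotics.\<close>

theorem sqrt_singularity:
  fixes F S :: "real fps"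
  assumes nonneg: "\<And>n. fps_nth F n \<ge> 0" and pos: "fps_nth F 2 > 0" "fps_nth F 3 > 0"
    and \<rho>: "0 < \<rho>" "ereal \<rho> < fps_conv_radius F" "eval_fps F \<rho> = 1"
    and S: "S ^ 2 = 1 - F"
  shows "fps_conv_radius S \<ge> ereal \<rho>"
    and "\<exists>L. L \<noteq> 0 \<and> (\<lambda>n. fps_nth S n * \<rho> ^ n * real n powr (3/2)) \<longlonglongrightarrow> L"
proof -
  define Q where "Q = sqrt_linear (- 1 / of_real \<rho> :: complex)"
  obtain G0 where G0: "ereal \<rho> < fps_conv_radius G0" "eval_fps G0 (of_real \<rho>) \<noteq> 0"
    "(Q * G0) ^ 2 = 1 - complex_fps F"
    unfolding Q_def using sqrt_factorization[OF nonneg pos \<rho>] .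
  have "complex_fps S ^ 2 = (Q * G0) ^ 2"
    unfolding G0(3) complex_fps_one_minus[symmetric] S[symmetric]
    by (simp add: power2_eq_square complex_fps_mult)
  \<comment> \<open>Formal series form an integral domain, so the square root is unique up to sign;
    the sign is absorbed into \<open>G\<close>.\<close>
  then have "complex_fps S = Q * G0 \<or> complex_fps S = Q * (- G0)"
    by (simp add: power2_eq_iff)
  then obtain G where G: "ereal \<rho> < fps_conv_radius G" "eval_fps G (of_real \<rho>) \<noteq> 0"
    "complex_fps S = Q * G"
  proof
    assume "complex_fps S = Q * G0"
    then show ?thesis using G0(1,2) that by blast
  next
    assume "complex_fps S = Q * (- G0)"
    moreover have "eval_fps (- G0) (of_real \<rho>) \<noteq> 0"
      using G0(1,2) \<rho>(1) by (subst eval_fps_minus) auto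
    ultimately show ?thesis using G0(1) that[of "- G0"] by simp
  qed
  have "fps_conv_radius Q \<ge> ereal \<rho>"
    using sqrt_linear_conv_radius[of "- 1 / of_real \<rho> :: complex"] \<rho> by (simp add: Q_def norm_divide)
  then have "fps_conv_radius (Q * G) \<ge> ereal \<rho>"
    using fps_conv_radius_mult_ge[of "ereal \<rho>" Q G] G(1) by simp
  then show "fps_conv_radius S \<ge> ereal \<rho>"
    by (simp flip: G(3))
  define q where "q n = fps_nth Q n * of_real \<rho> ^ n" for n
  define g where "g n = fps_nth G n * of_real \<rho> ^ n" for n
  have q: "q n = of_real ((-1) ^ n * ((1/2) gchoose n))" for n
  proof -
    have "((1/2) gchoose n) = complex_of_real ((1/2) gchoose n)"
      by (simp add: gbinomial_prod_rev)
    moreover have "(- 1 / complex_of_real \<rho>) ^ n * of_real \<rho> ^ n = (- 1) ^ n"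
      unfolding power_mult_distrib[symmetric] using \<rho>(1) by simp
    ultimately show ?thesis
      unfolding q_def Q_def sqrt_linear_nth by (simp add: mult_ac)
  qed
  have coeff: "of_real (fps_nth S n * \<rho> ^ n) = (\<Sum>j\<le>n. q (n - j) * g j)" for n
  proof -
    have "of_real (fps_nth S n) = fps_nth (G * Q) n"
      using G(3) by (metis complex_fps_nth mult.commute)
    then have "of_real (fps_nth S n * \<rho> ^ n) = (\<Sum>j\<le>n. fps_nth G j * fps_nth Q (n - j) * of_real \<rho> ^ n)"
      by (simp add: fps_mult_nth atLeast0AtMost sum_distrib_right)
    also have "\<dots> = (\<Sum>j\<le>n. q (n - j) * g j)"
      by (intro sum.cong refl) (simp add: q_def g_def mult_ac flip: power_add)
    finally show ?thesis .
  qed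
  define L where "L = complex_of_real (inverse (Gamma (- 1/2))) * eval_fps G (of_real \<rho>)"
  have "(\<lambda>n. q n * of_real (real n powr (3/2))) \<longlonglongrightarrow> of_real (inverse (Gamma (- 1/2)))"
    using tendsto_of_real[OF gchoose_half_asymptotic, where 'a = complex] by (simp add: q)
  moreover have "summable (\<lambda>j. norm (g j) * (real j + 1) ^ 2)"
    unfolding g_def by (rule summable_polynomial_weight[OF \<rho>(1) G(1)])
  moreover have "L = complex_of_real (inverse (Gamma (- 1/2))) * suminf g"
    by (simp only: L_def eval_fps_def g_def[abs_def])
  ultimately have "(\<lambda>n. (\<Sum>j\<le>n. q (n - j) * g j) * of_real (real n powr (3/2))) \<longlonglongrightarrow> L"
    using convolution_powr_limit[of q "of_real (inverse (Gamma (- 1/2)))" g] by simp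
  then have lim: "(\<lambda>n. complex_of_real (fps_nth S n * \<rho> ^ n * real n powr (3/2))) \<longlonglongrightarrow> L"
    by (simp flip: coeff)
  have "L \<noteq> 0"
    using G(2) Gamma_minus_half_nonzero by (simp add: L_def)
  \<comment> \<open>The sequence is real, hence so is its limit, and the real part alone must be
    nonzero.\<close>
  moreover have "Im L = 0"
    using tendsto_Im[OF lim] by (simp add: LIMSEQ_const_iff)
  ultimately have "Re L \<noteq> 0"
    by (simp add: complex_eq_iff)
  moreover have "(\<lambda>n. fps_nth S n * \<rho> ^ n * real n powr (3/2)) \<longlonglongrightarrow> Re L"
    using tendsto_Re[OF lim] by simp
  ultimately show "\<exists>L. L \<noteq> 0 \<and> (\<lambda>n. fps_nth S n * \<rho> ^ n * real n powr (3/2)) \<longlonglongrightarrow> L"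
    by blast
qed

section \<open>The dominant singularities\<close>

lemma eval_fps_strict_mono:
  fixes F :: "real fps"
  assumes nonneg: "\<And>n. fps_nth F n \<ge> 0" and pos: "fps_nth F m > 0" "m > 0"
    and xy: "0 \<le> x" "x < y" "ereal y < fps_conv_radius F"
  shows "eval_fps F x < eval_fps F y"
proof -
  have "ereal (norm y) < fps_conv_radius F" "ereal (norm x) < fps_conv_radius F"
    using xy by (auto intro: less_trans[of _ "ereal y"])
  then have sum: "summable (\<lambda>n. fps_nth F n * y ^ n)" "summable (\<lambda>n. fps_nth F n * x ^ n)"
    by (auto intro: summable_fps)
  have "0 < (\<Sum>n. fps_nth F n * y ^ n - fps_nth F n * x ^ n)"
  proof (rule suminf_pos2[where i = m])
    show "0 \<le> fps_nth F n * y ^ n - fps_nth F n * x ^ n" for n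
      using nonneg[of n] xy by (simp add: mult_left_mono power_mono)
    show "0 < fps_nth F m * y ^ m - fps_nth F m * x ^ m"
      using pos xy by (simp add: power_strict_mono)
  qed (rule summable_diff[OF sum])
  also have "\<dots> = eval_fps F y - eval_fps F x"
    by (simp add: eval_fps_def suminf_diff[OF sum])
  finally show ?thesis by simp
qed

text \<open>The bound at \<open>1/3\<close> carries the induction: with \<open>S = sqrt (1 - F)\<close> the next
  series is \<open>4 x\<^sup>2 + 2 x (1 - S x)\<close>, which is again below \<open>4/9 + 2/3 \<cdot> 2/3 = 8/9\<close> at
  \<open>1/3\<close>, and it reaches \<open>4 \<rho>\<^sup>2 + 2 \<rho> > 1\<close> at the old singularity \<open>\<rho> > 1/3\<close>, so the
  new singularity lies strictly between the two points.\<close>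

definition critical :: "nat \<Rightarrow> real \<Rightarrow> bool" where
  "critical k \<rho> \<longleftrightarrow>
     1/3 < \<rho> \<and> ereal \<rho> < fps_conv_radius (F_fps k) \<and> ereal \<rho> \<le> fps_conv_radius (S_fps k) \<and>
     eval_fps (F_fps k) \<rho> = 1 \<and> eval_fps (F_fps k) (1/3) < 8/9 \<and>
     (\<forall>x. 0 \<le> x \<and> x < \<rho> \<longrightarrow> eval_fps (F_fps k) x < 1) \<and>
     (\<forall>x. 0 \<le> x \<and> x \<le> \<rho> \<longrightarrow> R_tilde k (of_real x) = of_real (1 - eval_fps (F_fps k) x))"

lemma critical_smallest_positive_root:
  assumes "critical k \<rho>"
  shows "smallest_positive_root (R_tilde k) \<rho>"
  unfolding smallest_positive_root_def
proof (intro conjI allI impI)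
  show "0 < \<rho>" "R_tilde k (of_real \<rho>) = 0"
    using assms by (auto simp: critical_def)
next
  fix y :: real
  assume y: "y > 0" "R_tilde k (of_real y) = 0"
  show "\<rho> \<le> y"
  proof (rule ccontr)
    assume "\<not> \<rho> \<le> y"
    then have "eval_fps (F_fps k) y < 1" "R_tilde k (of_real y) = of_real (1 - eval_fps (F_fps k) y)"
      using assms y(1) unfolding critical_def by (meson less_imp_le not_le)+
    then show False
      using y(2) by (simp only: of_real_eq_0_iff) simp
  qed
qed

text \<open>The square fixes the value only up to sign. As \<open>S\<close> is 1 at 0 and its square
  has no zero on \<open>[0, x]\<close>, the intermediate value theorem excludes the negative
  root.\<close>

lemma eval_S_fps:
  assumes "critical k \<rho>" "0 \<le> x" "x < \<rho>"
  shows "eval_fps (S_fps k) x = sqrt (1 - eval_fps (F_fps k) x)"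
proof -
  have conv: "ereal (norm y) < fps_conv_radius (S_fps k)" "ereal (norm y) < fps_conv_radius (F_fps k)"
    if "0 \<le> y" "y \<le> x" for y
    using assms that by (auto simp: critical_def intro: less_le_trans[of _ "ereal \<rho>"] less_trans[of _ "ereal \<rho>"])
  have sq: "eval_fps (S_fps k) y ^ 2 = 1 - eval_fps (F_fps k) y" if "0 \<le> y" "y \<le> x" for y
  proof -
    have "eval_fps (S_fps k) y ^ 2 = eval_fps (S_fps k ^ 2) y"
      using conv[OF that] by (simp add: eval_fps_power)
    then show ?thesis
      using conv[OF that] by (simp add: S_fps_squared eval_fps_diff)
  qed
  have nz: "eval_fps (S_fps k) y \<noteq> 0" if "0 \<le> y" "y \<le> x" for y
    using sq[OF that] assms that by (force simp: critical_def)
  have "eval_fps (S_fps k) x \<ge> 0"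
  proof (rule ccontr)
    assume "\<not> eval_fps (S_fps k) x \<ge> 0"
    moreover have "eval_fps (S_fps k) 0 = 1"
      by (simp add: eval_fps_at_0 S_fps_def)
    moreover have "continuous_on {0..x} (eval_fps (S_fps k))"
      using conv by (intro continuous_on_eval_fps' continuous_on_id) (auto simp: in_eball_iff)
    ultimately obtain y where "0 \<le> y" "y \<le> x" "eval_fps (S_fps k) y = 0"
      using IVT2'[of "eval_fps (S_fps k)" x 0 0] assms by auto
    then show False using nz by blast
  qed
  then show ?thesis
    using sq[of x] assms by (metis order_refl real_sqrt_abs abs_of_nonneg)
qed

text \<open>Since \<open>2 z B = 1 - S\<close>, this is the formal version of the recursion for
  \<open>R_tilde\<close>, with \<open>S_fps k\<close> in place of the square root.\<close>

lemma F_fps_Suc: "F_fps (Suc k) = 4 * fps_X ^ 2 + 2 * fps_X * (1 - S_fps k)"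
  by (simp add: F_fps_def S_fps_def unary_subtree_fps_def algebra_simps power2_eq_square)

lemma fps_conv_radius_F_fps_Suc: "fps_conv_radius (F_fps (Suc k)) \<ge> fps_conv_radius (S_fps k)"
  unfolding F_fps_Suc
  by (intro fps_conv_radius_add_ge fps_conv_radius_mult_ge fps_conv_radius_diff_ge) simp_all

lemma eval_F_fps_Suc:
  assumes "critical k \<rho>" "0 \<le> x" "x < \<rho>"
  shows "eval_fps (F_fps (Suc k)) x = 4 * x ^ 2 + 2 * x * (1 - sqrt (1 - eval_fps (F_fps k) x))"
proof -
  have S: "ereal (norm x) < fps_conv_radius (S_fps k)"
    using assms by (auto simp: critical_def intro: less_le_trans[of _ "ereal \<rho>"])
  have conv: "ereal (norm x) < fps_conv_radius (1 - S_fps k)"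
    using S fps_conv_radius_diff[of 1 "S_fps k"] by (auto intro: less_le_trans)
  have conv4: "fps_conv_radius (4 * fps_X ^ 2 :: real fps) = \<infinity>" "fps_conv_radius (2 * fps_X :: real fps) = \<infinity>"
    by (simp_all add: numeral_fps_const fps_conv_radius_cmult_left)
  have "ereal (norm x) < fps_conv_radius (2 * fps_X * (1 - S_fps k))"
    using conv conv4 fps_conv_radius_mult[of "2 * fps_X" "1 - S_fps k"] by (auto intro: less_le_trans)
  then have "eval_fps (F_fps (Suc k)) x = 4 * x ^ 2 + 2 * x * (1 - eval_fps (S_fps k) x)"
    unfolding F_fps_Suc using S conv conv4
    by (simp add: eval_fps_add eval_fps_mult eval_fps_diff)
  then show ?thesis
    using eval_S_fps[OF assms] by simp
qed

lemma critical_Suc: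
  assumes crit: "critical k \<rho>"
  obtains \<rho>' where "critical (Suc k) \<rho>'"
proof -
  note c = crit[unfolded critical_def]
  \<comment> \<open>The closed form for the next \<open>F\<close> is established only below
    \<open>\<rho>\<close>; \<open>\<phi>\<close> extends it continuously to \<open>\<rho>\<close>,
    as the intermediate value theorem requires.\<close>
  define \<phi> where "\<phi> x = 4 * x ^ 2 + 2 * x * (1 - sqrt (1 - eval_fps (F_fps k) x))" for x
  have eval: "eval_fps (F_fps (Suc k)) x = \<phi> x" if "0 \<le> x" "x < \<rho>" for x
    using eval_F_fps_Suc[OF crit that] by (simp add: \<phi>_def)
  have "{1/3..\<rho>} \<subseteq> eball 0 (fps_conv_radius (F_fps k))"
  proof
    fix x assume "x \<in> {1/3..\<rho>}"
    then have "norm x \<le> \<rho>" by auto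
    then show "x \<in> eball 0 (fps_conv_radius (F_fps k))"
      using c le_less_trans[of "ereal (norm x)" "ereal \<rho>"] by (simp add: in_eball_iff)
  qed
  then have "continuous_on {1/3..\<rho>} (eval_fps (F_fps k))"
    by (rule continuous_on_subset[OF continuous_on_eval_fps])
  then have cont: "continuous_on {1/3..\<rho>} \<phi>"
    unfolding \<phi>_def
    by (intro continuous_on_add continuous_on_mult continuous_on_diff continuous_on_real_sqrt
        continuous_on_power continuous_on_const continuous_on_id)
  have "1/3 < sqrt (1 - eval_fps (F_fps k) (1/3))"
    using c by (intro real_less_rsqrt) (auto simp: power2_eq_square)
  then have third: "\<phi> (1/3) < 8/9"
    by (simp add: \<phi>_def power2_eq_square)
  have "(1/3) ^ 2 < \<rho> ^ 2"
    using c by (intro power_strict_mono) auto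
  then have "\<phi> \<rho> > 1"
    using c by (simp add: \<phi>_def power2_eq_square)
  then obtain \<rho>' where \<rho>': "1/3 \<le> \<rho>'" "\<rho>' \<le> \<rho>" "\<phi> \<rho>' = 1"
    using IVT'[of \<phi> "1/3" 1 \<rho>] third c cont by auto
  have "\<rho>' \<noteq> 1/3"
  proof
    assume "\<rho>' = 1/3"
    then have "\<phi> (1/3) = 1"
      using \<rho>'(3) by (simp only:)
    then show False
      using third by linarith
  qed
  moreover have "\<rho>' \<noteq> \<rho>"
    using \<rho>'(3) \<open>\<phi> \<rho> > 1\<close> by auto
  ultimately have lt: "1/3 < \<rho>'" "\<rho>' < \<rho>"
    using \<rho>'(1,2) by linarith+
  have conv: "ereal \<rho>' < fps_conv_radius (F_fps (Suc k))"
    using lt c fps_conv_radius_F_fps_Suc[of k] by (auto intro: less_le_trans[of _ "ereal \<rho>"] order_trans)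
  have "critical (Suc k) \<rho>'"
    unfolding critical_def
  proof (intro conjI allI impI)
    show "eval_fps (F_fps (Suc k)) \<rho>' = 1" "eval_fps (F_fps (Suc k)) (1/3) < 8/9"
      using eval[of \<rho>'] eval[of "1/3"] lt \<rho>' third by auto
    \<comment> \<open>The square-root factorization at the new level bounds the radius of the new
      \<open>S\<close>.\<close>
    then show "ereal \<rho>' \<le> fps_conv_radius (S_fps (Suc k))"
      using lt conv sqrt_singularity(1)[OF F_fps_nonneg F_fps_coeffs_pos, of \<rho>' k "S_fps (Suc k)"]
      by (simp add: S_fps_squared)
    show "eval_fps (F_fps (Suc k)) x < 1" if "0 \<le> x \<and> x < \<rho>'" for x
      using eval_fps_strict_mono[OF F_fps_nonneg F_fps_coeffs_pos(1)[of k], of x \<rho>'] that conv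
        \<open>eval_fps (F_fps (Suc k)) \<rho>' = 1\<close> by simp
    show "R_tilde (Suc k) (of_real x) = of_real (1 - eval_fps (F_fps (Suc k)) x)" if "0 \<le> x \<and> x \<le> \<rho>'" for x
    proof -
      have x: "0 \<le> x" "x < \<rho>" using that lt by auto
      \<comment> \<open>For \<open>x < \<rho>\<close> the argument is a positive real, where the
        principal branch is the real square root.\<close>
      then have "csqrt (R_tilde k (of_real x)) = of_real (sqrt (1 - eval_fps (F_fps k) x))"
        using c by (subst csqrt_of_real[symmetric]) (auto simp: less_imp_le)
      then show ?thesis
        using x by (simp add: eval \<phi>_def algebra_simps)
    qed
  qed (use lt conv in auto)
  then show ?thesis by (rule that)
qed

lemma critical_0: "critical 0 (1/2)"
proof -
  have F0: "F_fps 0 = fps_const 4 * fps_X ^ 2"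
    by (simp add: F_fps_def unary_subtree_fps_def numeral_fps_const)
  have conv: "fps_conv_radius (F_fps 0) = \<infinity>"
    unfolding F0 by (simp add: fps_conv_radius_cmult_left)
  have eval: "eval_fps (F_fps 0) x = 4 * x ^ 2" for x
    unfolding F0 by (simp add: eval_fps_mult)
  \<comment> \<open>Without a cubic term \<open>sqrt_singularity\<close> does not apply; the radius
    is read off from \<open>sqrt (1 + 2 z) * sqrt (1 - 2 z)\<close> instead.\<close>
  have "S_fps 0 ^ 2 = (sqrt_linear 2 * sqrt_linear (- 2)) ^ 2"
    unfolding S_fps_squared power_mult_distrib sqrt_linear_squared F0
    by (simp add: algebra_simps power2_eq_square flip: fps_const_mult fps_const_neg numeral_fps_const)
  then have "S_fps 0 = sqrt_linear 2 * sqrt_linear (- 2) \<or> S_fps 0 = - (sqrt_linear 2 * sqrt_linear (- 2))"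
    by (simp add: power2_eq_iff)
  then have "fps_conv_radius (S_fps 0) = fps_conv_radius (sqrt_linear 2 * sqrt_linear (- 2 :: real))"
    by auto
  also have "\<dots> \<ge> ereal (1/2)"
    using sqrt_linear_conv_radius[of "2::real"] sqrt_linear_conv_radius[of "- 2::real"]
    by (intro fps_conv_radius_mult_ge) auto
  finally have "fps_conv_radius (S_fps 0) \<ge> ereal (1/2)" .
  moreover have "4 * x ^ 2 < 1" if "0 \<le> x" "x < 1/2" for x :: real
    using power_strict_mono[OF that(2,1), of 2] by (simp add: power2_eq_square)
  ultimately show ?thesis
    by (auto simp: critical_def conv eval power2_eq_square)
qed

lemma critical_exists: "\<exists>\<rho>. critical k \<rho>"
  by (induction k) (use critical_0 critical_Suc in blast)+

section \<open>Coefficient asymptotics\<close>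

text \<open>Up to sign, \<open>S_fps 0\<close> is the binomial series of
  \<open>sqrt (1 - 4 z^2)\<close>, so its even coefficients are explicit.\<close>

lemma S_fps_0_limit:
  "\<exists>L. L \<noteq> 0 \<and> (\<lambda>m. fps_nth (S_fps 0) (2 * m) * (1/2) ^ (2 * m) * real (2 * m) powr (3/2)) \<longlonglongrightarrow> L"
proof -
  define T :: "real fps" where "T = fps_binomial (1/2) oo (fps_const (- 4) * fps_X ^ 2)"
  have "T ^ 2 = 1 + fps_const (- 4) * fps_X ^ 2"
    by (simp add: T_def fps_compose_power fps_binomial_half_squared fps_compose_add_distrib)
  also have "\<dots> = S_fps 0 ^ 2"
    by (simp add: S_fps_squared F_fps_def unary_subtree_fps_def flip: fps_const_neg numeral_fps_const)
  finally have "S_fps 0 = T \<or> S_fps 0 = - T"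
    by (auto simp: power2_eq_iff)
  then obtain s :: real where s: "s \<noteq> 0" "\<And>n. fps_nth (S_fps 0) n = s * fps_nth T n"
    by (metis fps_neg_nth mult_1 mult_minus1 neg_equal_0_iff_equal one_neq_zero)
  have T: "fps_nth T (2 * m) = (- 4) ^ m * ((1/2) gchoose m)" for m
  proof -
    have pow: "fps_nth ((fps_const (- 4 :: real) * fps_X ^ 2) ^ i) n = (if n = 2 * i then (- 4) ^ i else 0)" for i n
      unfolding power_mult_distrib fps_const_power power_mult[symmetric]
      by (simp only: fps_mult_left_const_nth fps_X_power_nth) simp
    have "fps_nth T (2 * m) = (\<Sum>i = 0..2*m. if i = m then (- 4) ^ m * ((1/2) gchoose m) else 0)"
      unfolding T_def fps_compose_nth pow by (intro sum.cong) auto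
    then show ?thesis by simp
  qed
  have "fps_nth (S_fps 0) (2 * m) * (1/2) ^ (2 * m) * real (2 * m) powr (3/2) =
      s * 2 powr (3/2) * ((-1) ^ m * ((1/2) gchoose m) * real m powr (3/2))" for m
  proof -
    have "(- 4 :: real) ^ m * (1/2) ^ (2 * m) = (-1) ^ m"
      unfolding power_mult power_mult_distrib[symmetric] by (simp add: power2_eq_square)
    then have "fps_nth (S_fps 0) (2 * m) * (1/2) ^ (2 * m) = s * ((-1) ^ m * ((1/2) gchoose m))"
      unfolding s(2) T by (simp add: mult_ac)
    then show ?thesis
      by (simp add: powr_mult mult_ac)
  qed
  then have "(\<lambda>m. fps_nth (S_fps 0) (2 * m) * (1/2) ^ (2 * m) * real (2 * m) powr (3/2))
      \<longlonglongrightarrow> s * 2 powr (3/2) * inverse (Gamma (- 1/2))"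
    by (simp only:) (intro tendsto_intros gchoose_half_asymptotic)
  then show ?thesis
    using s Gamma_minus_half_nonzero by (intro exI conjI) auto
qed

lemma sizes_at_top_le: "sizes_at_top k \<le> sequentially"
  by (simp add: sizes_at_top_def)

text \<open>Needed to pass the sign of the coefficients to the limit.\<close>

lemma sizes_at_top_nontrivial: "sizes_at_top k \<noteq> bot"
proof -
  have "\<not> (\<forall>\<^sub>F n in sequentially. n \<notin> {n::nat. odd n})"
  proof
    assume "\<forall>\<^sub>F n in sequentially. n \<notin> {n::nat. odd n}"
    then obtain N :: nat where "\<forall>n\<ge>N. even n"
      by (auto simp: eventually_sequentially)
    then have "even (2 * N + 1)" by (rule allE[of _ "2 * N + 1"]) linarith
    then show False by simp
  qed
  then show ?thesis
    by (auto simp: sizes_at_top_def trivial_limit_def eventually_inf_principal)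
qed

text \<open>The index \<open>Suc n\<close> fits coefficient \<open>n\<close> of
  \<open>B_le k\<close>; for \<open>k = 0\<close>, odd \<open>n\<close> thus correspond to the even
  coefficients of \<open>S\<close>.\<close>

lemma S_fps_limit:
  assumes "critical k \<rho>" "k = 0 \<longrightarrow> \<rho> = 1/2"
  obtains L where "L \<noteq> 0"
    "((\<lambda>n. fps_nth (S_fps k) (Suc n) * \<rho> ^ Suc n * real (Suc n) powr (3/2)) \<longlongrightarrow> L) (sizes_at_top k)"
proof (cases k)
  case 0
  define a where "a m = fps_nth (S_fps 0) (2 * m) * (1/2) ^ (2 * m) * real (2 * m) powr (3/2)" for m
  obtain L where L: "L \<noteq> 0" "a \<longlonglongrightarrow> L"
    using S_fps_0_limit unfolding a_def by blast
  have "filterlim (\<lambda>n. Suc n div 2) at_top sequentially"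
    unfolding filterlim_at_top
  proof
    fix Z :: nat
    show "\<forall>\<^sub>F n in sequentially. Z \<le> Suc n div 2"
      using eventually_ge_at_top[of "2 * Z"] by eventually_elim linarith
  qed
  then have "((\<lambda>n. a (Suc n div 2)) \<longlongrightarrow> L) (sizes_at_top k)"
    by (intro tendsto_mono[OF sizes_at_top_le] filterlim_compose[OF L(2)])
  moreover have "\<forall>\<^sub>F n in sizes_at_top k. a (Suc n div 2) =
      fps_nth (S_fps k) (Suc n) * \<rho> ^ Suc n * real (Suc n) powr (3/2)"
  proof -
    have "a (Suc n div 2) = fps_nth (S_fps k) (Suc n) * \<rho> ^ Suc n * real (Suc n) powr (3/2)" if "odd n" for n
    proof -
      have "2 * (Suc n div 2) = Suc n" using that by simp
      moreover have "\<rho> = 1/2" using 0 assms(2) by simp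
      ultimately show ?thesis
        unfolding a_def 0 by (simp only:)
    qed
    then show ?thesis
      using 0 by (auto simp: sizes_at_top_def eventually_inf_principal)
  qed
  ultimately show ?thesis
    using that[OF L(1)] by (simp add: tendsto_cong)
next
  case (Suc j)
  obtain L where L: "L \<noteq> 0" "(\<lambda>n. fps_nth (S_fps k) n * \<rho> ^ n * real n powr (3/2)) \<longlonglongrightarrow> L"
    using assms sqrt_singularity(2)[OF F_fps_nonneg F_fps_coeffs_pos, of \<rho> j "S_fps k"] Suc
    by (auto simp: critical_def S_fps_squared)
  show ?thesis
    using that[OF L(1)] LIMSEQ_Suc[OF L(2)] Suc by (simp add: sizes_at_top_def)
qed

theorem proposition3:
  fixes k :: nat
  shows "\<exists>\<rho> C :: real. smallest_positive_root (R_tilde k) \<rho> \<and> C > 0 \<and>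
    fps_nth (B_le k) \<sim>[sizes_at_top k]
      (\<lambda>n. C * \<rho> powi (- int n) * real n powr (- 3 / 2))"
proof -
  obtain \<rho> where \<rho>: "critical k \<rho>" "k = 0 \<longrightarrow> \<rho> = 1/2"
    using critical_exists[of k] critical_0 that by (cases "k = 0") blast+
  have \<rho>_pos: "\<rho> > 0"
    using \<rho> by (simp add: critical_def)
  obtain L where L: "L \<noteq> 0"
    "((\<lambda>n. fps_nth (S_fps k) (Suc n) * \<rho> ^ Suc n * real (Suc n) powr (3/2)) \<longlongrightarrow> L) (sizes_at_top k)"
    using S_fps_limit[OF \<rho>] .
  \<comment> \<open>The factor -1/2 converts coefficients of \<open>S\<close> into those of
    \<open>B\<close>, and \<open>1 / \<rho>\<close> removes the surplus power from the index shift.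
    The final 1 is the limit of the ratio of the two polynomial weights.\<close>
  define C where "C = - 1 / (2 * \<rho>) * L * 1"
  have "(\<lambda>n. real n powr (3/2) / real (Suc n) powr (3/2)) \<longlonglongrightarrow> 1"
    by real_asymp
  then have "((\<lambda>n. - 1 / (2 * \<rho>) * (fps_nth (S_fps k) (Suc n) * \<rho> ^ Suc n * real (Suc n) powr (3/2)) *
      (real n powr (3/2) / real (Suc n) powr (3/2))) \<longlongrightarrow> C) (sizes_at_top k)"
    unfolding C_def by (intro tendsto_mult tendsto_const L(2) tendsto_mono[OF sizes_at_top_le])
  \<comment> \<open>At \<open>n = 0\<close> both sides are 0, because \<open>0 powr a = 0\<close>
    and the coefficient vanishes.\<close>
  moreover have "- 1 / (2 * \<rho>) * (fps_nth (S_fps k) (Suc n) * \<rho> ^ Suc n * real (Suc n) powr (3/2)) *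
      (real n powr (3/2) / real (Suc n) powr (3/2)) =
      fps_nth (B_le k) n / (\<rho> powi (- int n) * real n powr (- 3/2))" for n
    using \<rho>_pos by (simp add: S_fps_nth_Suc power_int_minus powr_minus field_simps)
  ultimately have lim: "((\<lambda>n. fps_nth (B_le k) n / (\<rho> powi (- int n) * real n powr (- 3/2))) \<longlongrightarrow> C)
      (sizes_at_top k)"
    by simp
  have "C \<ge> 0"
    using lim \<rho>_pos by (rule_tac tendsto_lowerbound[OF _ _ sizes_at_top_nontrivial])
      (auto intro!: always_eventually divide_nonneg_nonneg simp: B_le_nth_nonneg)
  moreover have "C \<noteq> 0"
    using L(1) \<rho>_pos by (simp add: C_def)
  moreover have "fps_nth (B_le k) \<sim>[sizes_at_top k]
      (\<lambda>n. C * (\<rho> powi (- int n) * real n powr (- 3 / 2)))"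
    by (rule asymp_equivI'_const[OF lim]) fact
  ultimately show ?thesis
    using critical_smallest_positive_root[OF \<rho>(1)] by (intro exI[of _ \<rho>] exI[of _ C]) (simp add: mult.assoc)
qed

end
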